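(* Let $X$ be a finite set, let $f$ be a symmetric submodular function on the subsets of $X$, let $k$ be a natural number, and let $T$ be a family of separations of $X$. Then $T$ is a Tangle of separations of order $k+1$ on $(X,f)$ if and only if $F=\{(A,B)\mid (B,A)\in T\}$ is an Ultrafilter of separations of order $k+1$ on $(X,f)$.
   Context: A function $f:2^X\to\mathbb{N}$ (natural numbers including $0$) is symmetric submodular if $f(A)=f(X\setminus A)$ for all $A\subseteq X$ and $f(A)+f(B)\ge f(A\cap B)+f(A\cup B)$ for all $A,B\subseteq X$. A separation of $X$ is an ordered pair $(A,B)$ of subsets with $A\cup B=X$ and $A\cap B=\emptyset$ (empty sides are allowed). The order of a separation $(A,B)$ is $f(A)$. For separations, $(A,B)\le(C,D)$ means $A\subseteq C$ and $B\supseteq D$. A Tangle of separations in $(X,f)$ of order $k+1$ is a family $T$ of separations of $X$, each of order $\le k$, such that: (T1) for every separation $(A,B)$ of $X$ of order $\le k$, one of $(A,B),(B,A)$ is an element of $T$; (T2) for each $e\in X$ with $f(\{e\})\le k$, $(\{e\},X\setminus\{e\})\in T$; (T3) if $(A_1,B_1),(A_2,B_2),(A_3,B_3)\in T$ (not necessarily distinct) then $A_1\cup A_2\cup A_3\ne X$. An Ultrafilter of separations in $(X,f)$ of order $k+1$ is a family $F$ of separations of $X$, each of order $\le k$, such that: (F1) for every separation $(A,B)$ of $X$ of order $\le k$, one of $(A,B),(B,A)$ is an element of $F$; (F2) $(\emptyset,X)\notin F$; (F3) for each $e\in X$ with $f(\{e\})\le k$, $(\{e\},X\setminus\{e\})\notin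 F$; (F4) if $(A_1,B_1)\in F$, $(A_1,B_1)\le(A_2,B_2)$ and the order of the separation $(A_2,B_2)$ is $\le k$, then $(A_2,B_2)\in F$; (F5) if $(A_1,B_1)\in F$, $(A_2,B_2)\in F$ and the order of $(A_1\cap A_2,B_1\cup B_2)$ is $\le k$, then $(A_1\cap A_2,B_1\cup B_2)\in F$. *)

theory Defs
  imports Main
begin

definition symmetric_submodular :: "'a set \<Rightarrow> ('a set \<Rightarrow> nat) \<Rightarrow> bool" where
  "symmetric_submodular X f \<longleftrightarrow>
     (\<forall>A. A \<subseteq> X \<longrightarrow> f A = f (X - A)) \<and>
     (\<forall>A B. A \<subseteq> X \<longrightarrow> B \<subseteq> X \<longrightarrow> f A + f B \<ge> f (A \<inter> B) + f (A \<union> B))"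

definition separations :: "'a set \<Rightarrow> ('a set \<times> 'a set) set" where
  "separations X = {(A, B). A \<union> B = X \<and> A \<inter> B = {}}"

definition sep_order :: "('a set \<Rightarrow> nat) \<Rightarrow> 'a set \<times> 'a set \<Rightarrow> nat" where
  "sep_order f S = f (fst S)"

definition sep_le :: "'a set \<times> 'a set \<Rightarrow> 'a set \<times> 'a set \<Rightarrow> bool" where
  "sep_le S S' \<longleftrightarrow> fst S \<subseteq> fst S' \<and> snd S \<supseteq> snd S'"

(* The parameter k of the next two definitions bounds the orders of the members;
   the tangle or ultrafilter itself has order k + 1. *)
definition tangle ::
  "'a set \<Rightarrow> ('a set \<Rightarrow> nat) \<Rightarrow> nat \<Rightarrow> ('a set \<times> 'a set) set \<Rightarrow> bool" where
  "tangle X f k T \<longleftrightarrow>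
     T \<subseteq> separations X \<and> (\<forall>S \<in> T. sep_order f S \<le> k) \<and>
     (\<forall>A B. (A, B) \<in> separations X \<and> sep_order f (A, B) \<le> k
        \<longrightarrow> (A, B) \<in> T \<or> (B, A) \<in> T) \<and>
     (\<forall>e \<in> X. f {e} \<le> k \<longrightarrow> ({e}, X - {e}) \<in> T) \<and>
     (\<forall>A1 B1 A2 B2 A3 B3. (A1, B1) \<in> T \<and> (A2, B2) \<in> T \<and> (A3, B3) \<in> T
        \<longrightarrow> A1 \<union> A2 \<union> A3 \<noteq> X)"

definition ultrafilter_of_separations ::
  "'a set \<Rightarrow> ('a set \<Rightarrow> nat) \<Rightarrow> nat \<Rightarrow> ('a set \<times> 'a set) set \<Rightarrow> bool" where
  "ultrafilter_of_separations X f k F \<longleftrightarrow>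
     F \<subseteq> separations X \<and> (\<forall>S \<in> F. sep_order f S \<le> k) \<and>
     (\<forall>A B. (A, B) \<in> separations X \<and> sep_order f (A, B) \<le> k
        \<longrightarrow> (A, B) \<in> F \<or> (B, A) \<in> F) \<and>
     ({}, X) \<notin> F \<and>
     (\<forall>e \<in> X. f {e} \<le> k \<longrightarrow> ({e}, X - {e}) \<notin> F) \<and>
     (\<forall>A1 B1 A2 B2. (A1, B1) \<in> F \<and> (A2, B2) \<in> separations X \<and>
        sep_le (A1, B1) (A2, B2) \<and> sep_order f (A2, B2) \<le> k
        \<longrightarrow> (A2, B2) \<in> F) \<and>
     (\<forall>A1 B1 A2 B2. (A1, B1) \<in> F \<and> (A2, B2) \<in> F \<and>
        sep_order f (A1 \<inter> A2, B1 \<union> B2) \<le> k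
        \<longrightarrow> (A1 \<inter> A2, B1 \<union> B2) \<in> F)"

end

theory Submission
  imports Defs
begin

text \<open>
  Call \<open>A\<close> small if \<open>(A, X - A) \<in> T\<close>. The tangle axioms give the ultrafilter axioms at once: if an
  ultrafilter axiom failed, then by (T1) the complement of the set in question would be small, and
  at most three small sets would cover \<open>X\<close>. Conversely, let three small sets cover \<open>X\<close>. Since
  \<open>f (A - B) + f (B - A) \<le> f A + f B\<close>, one of two small sets \<open>A\<close>, \<open>B\<close> can be replaced by its
  difference with the other and remains small, so the cover may be taken pairwise disjoint. Then
  the union of two members is the complement of the third, so it has order at most \<open>k\<close> and is
  small by (F5); by (F5) again \<open>X\<close> itself is small, against (F2).
\<close>

lemma separations_iff: "(A, B) \<in> separations X \<longleftrightarrow> A \<subseteq> X \<and> B = X - A"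
  unfolding separations_def by auto

lemma symmetric_submodularD:
  assumes "symmetric_submodular X f" "A \<subseteq> X"
  shows "f (X - A) = f A"
    and "B \<subseteq> X \<Longrightarrow> f (A \<inter> B) + f (A \<union> B) \<le> f A + f B"
  using assms unfolding symmetric_submodular_def by metis+

text \<open>Apply submodularity to \<open>A\<close> and \<open>X - B\<close>: their intersection is
  \<open>A - B\<close>, their union is the complement of \<open>B - A\<close>, and symmetry removes
  both complements.\<close>

lemma symmetric_submodular_diff:
  assumes "symmetric_submodular X f" "A \<subseteq> X" "B \<subseteq> X"
  shows "f (A - B) + f (B - A) \<le> f A + f B"
proof -
  have "f (A \<inter> (X - B)) + f (A \<union> (X - B)) \<le> f A + f (X - B)"
    using symmetric_submodularD(2)[OF assms(1,2)] by simp
  moreover have "A \<inter> (X - B) = A - B" "A \<union> (X - B) = X - (B - A)"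
    using assms(2,3) by auto
  moreover have "f (X - (B - A)) = f (B - A)" "f (X - B) = f B"
    using symmetric_submodularD(1)[OF assms(1)] assms(3) by (blast, blast)
  ultimately show ?thesis
    by simp
qed

text \<open>Submodularity for \<open>A\<close> and its complement bounds \<open>f {} + f X\<close>
  by twice \<open>f A\<close>, and \<open>f {} = f X\<close> by symmetry.\<close>

lemma symmetric_submodular_ground_le:
  assumes "symmetric_submodular X f" "A \<subseteq> X"
  shows "f X \<le> f A"
proof -
  have "f (X - A) = f A" "f {} = f X"
    using symmetric_submodularD(1)[OF assms] symmetric_submodularD(1)[OF assms(1), of X] by simp_all
  moreover have "f (A \<inter> (X - A)) + f (A \<union> (X - A)) \<le> f A + f (X - A)"
    using symmetric_submodularD(2)[OF assms] by blast
  moreover have "A \<inter> (X - A) = {}" "A \<union> (X - A) = X"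
    using assms(2) by auto
  ultimately show ?thesis
    by simp
qed

text \<open>The two differences have total order at most \<open>2 * k\<close>, so one of them has
  order at most \<open>k\<close>. Passing to it removes only points that lie in the other set, which
  preserves the union.\<close>

lemma disjoint_small_refinement:
  assumes "symmetric_submodular X f"
    and small: "\<And>A. small A \<Longrightarrow> A \<subseteq> X \<and> f A \<le> k"
    and down: "\<And>A B. small A \<Longrightarrow> B \<subseteq> A \<Longrightarrow> f B \<le> k \<Longrightarrow> small B"
    and "small A" "small B"
  obtains A' B' where "small A'" "small B'" "A' \<subseteq> A" "B' \<subseteq> B" "A' \<inter> B' = {}" "A' \<union> B' = A \<union> B"
proof -
  have "f (A - B) + f (B - A) \<le> f A + f B"
    using symmetric_submodular_diff[OF assms(1)] small assms(4,5) by blast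
  then have "f (A - B) \<le> k \<or> f (B - A) \<le> k"
    using small[OF assms(4)] small[OF assms(5)] by linarith
  then show thesis
  proof
    assume "f (A - B) \<le> k"
    then have "small (A - B)"
      using down[OF assms(4), of "A - B"] by blast
    then show thesis
      using that[of "A - B" B] assms(5) by blast
  next
    assume "f (B - A) \<le> k"
    then have "small (B - A)"
      using down[OF assms(5), of "B - A"] by blast
    then show thesis
      using that[of A "B - A"] assms(4) by blast
  qed
qed

lemma three_small_sets_no_cover:
  assumes ssm: "symmetric_submodular X f"
    and small: "\<And>A. small A \<Longrightarrow> A \<subseteq> X \<and> f A \<le> k"
    and down: "\<And>A B. small A \<Longrightarrow> B \<subseteq> A \<Longrightarrow> f B \<le> k \<Longrightarrow> small B"
    and union: "\<And>A B. small A \<Longrightarrow> small B \<Longrightarrow> f (A \<union> B) \<le> k \<Longrightarrow> small (A \<union> B)"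
    and "\<not> small X"
    and sm: "small A" "small B" "small C"
  shows "A \<union> B \<union> C \<noteq> X"
proof
  assume cover: "A \<union> B \<union> C = X"
  have refine: "\<exists>A' B'. small A' \<and> small B' \<and> A' \<subseteq> A \<and> B' \<subseteq> B \<and> A' \<inter> B' = {} \<and> A' \<union> B' = A \<union> B"
    if "small A" "small B" for A B
    by (rule disjoint_small_refinement[of X f small k A B]) (use ssm small down that in blast)+
  \<comment> \<open>Each of the three pairs is refined once. Later refinements only shrink the sets,
    so the disjointness already gained persists, and the union of all three never changes.\<close>
  obtain A1 B1 where 1: "small A1" "small B1" "A1 \<inter> B1 = {}" "A1 \<union> B1 = A \<union> B"
    using refine[OF sm(1,2)] by blast
  obtain A2 C1 where 2: "small A2" "small C1" "A2 \<subseteq> A1" "A2 \<inter> C1 = {}" "A2 \<union> C1 = A1 \<union> C"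
    using refine[OF 1(1) sm(3)] by blast
  obtain B2 C2 where 3: "small B2" "small C2" "B2 \<subseteq> B1" "C2 \<subseteq> C1" "B2 \<inter> C2 = {}"
      "B2 \<union> C2 = B1 \<union> C1"
    using refine[OF 1(2) 2(2)] by blast
  have "A2 \<union> (B2 \<union> C2) = A \<union> B \<union> C"
    using 1(4) 2(5) 3(6) by blast
  then have "A2 \<union> B2 \<union> C2 = X"
    using cover by blast
  moreover from this have "A2 \<union> B2 = X - C2"
    using 1(3) 2(3,4) 3(3,4,5) by blast
  moreover have "f (X - C2) = f C2"
    using symmetric_submodularD(1)[OF ssm] small[OF 3(2)] by blast
  ultimately have "small (X - C2)"
    using union[OF 2(1) 3(1)] small[OF 3(2)] by simp
  \<comment> \<open>The second union is \<open>X\<close> itself, whose order must be bounded before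
    closure under unions applies.\<close>
  moreover have "f X \<le> k"
    using symmetric_submodular_ground_le[OF ssm, of C2] small[OF 3(2)] by linarith
  moreover have "(X - C2) \<union> C2 = X"
    using small[OF 3(2)] by blast
  ultimately have "small X"
    using union[of "X - C2" C2] 3(2) by simp
  with \<open>\<not> small X\<close> show False ..
qed

theorem theorem11:
  fixes X :: "'a set" and f :: "'a set \<Rightarrow> nat" and k :: nat
    and T :: "('a set \<times> 'a set) set"
  assumes "finite X"
    and "symmetric_submodular X f"
    and "T \<subseteq> separations X"
  shows "tangle X f k T \<longleftrightarrow>
    ultrafilter_of_separations X f k {(A, B). (B, A) \<in> T}"
proof -
  let ?F = "{(A, B). (B, A) \<in> T}"
  note sym = symmetric_submodularD(1)[OF assms(2)]
  have T_sep: "A \<subseteq> X" "B \<subseteq> X" "B = X - A" "A = X - B" if "(A, B) \<in> T" for A B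
    using that assms(3) unfolding separations_def by auto
  \<comment> \<open>The order of a separation is read off its first side; symmetry carries the bound
    over to the swapped pair.\<close>
  have order_swap: "f A = f B" if "(A, B) \<in> T" for A B
    using sym[OF T_sep(1)[OF that]] T_sep(3)[OF that] by metis
  have F_sep: "?F \<subseteq> separations X"
    using assms(3) unfolding separations_def by auto
  show ?thesis
  proof
    assume tangle: "tangle X f k T"
    have ord: "f A \<le> k" "f B \<le> k" if "(A, B) \<in> T" for A B
    proof -
      show "f A \<le> k"
        using tangle that unfolding tangle_def sep_order_def by force
      then show "f B \<le> k"
        using order_swap[OF that] by simp
    qed
    have T1: "(A, B) \<in> T \<or> (B, A) \<in> T" if "(A, B) \<in> separations X" "f A \<le> k" for A B
      using tangle that unfolding tangle_def sep_order_def by simp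
    have T2: "({e}, X - {e}) \<in> T" if "e \<in> X" "f {e} \<le> k" for e
      using tangle that unfolding tangle_def by blast
    have T3: "A1 \<union> A2 \<union> A3 \<noteq> X" if "(A1, B1) \<in> T" "(A2, B2) \<in> T" "(A3, B3) \<in> T"
      for A1 B1 A2 B2 A3 B3
      using tangle that unfolding tangle_def by blast
    \<comment> \<open>The ultrafilter axioms are stated through \<open>T\<close> with the sides
      swapped. Here \<open>B1\<close> is the complement of a subset of \<open>A2\<close>, so
      \<open>B1\<close> and \<open>A2\<close>, the latter taken twice, would violate (T3).\<close>
    have F4: "(B2, A2) \<in> T"
      if "(B1, A1) \<in> T" "(A2, B2) \<in> separations X" "A1 \<subseteq> A2" "f A2 \<le> k" for A1 B1 A2 B2
    proof (rule ccontr)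
      assume "(B2, A2) \<notin> T"
      then have "(A2, B2) \<in> T"
        using T1 that(2,4) by blast
      moreover have "B1 \<union> A2 \<union> A2 = X"
        using T_sep(1,4)[OF that(1)] that(2,3) unfolding separations_iff by blast
      ultimately show False
        using T3 that(1) by blast
    qed
    \<comment> \<open>The complement of \<open>B1 \<union> B2\<close> is
      \<open>A1 \<inter> A2\<close>, so with the wrong orientation \<open>B1\<close>,
      \<open>B2\<close> and \<open>A1 \<inter> A2\<close> would be a cover forbidden by
      (T3).\<close>
    have F5: "(B1 \<union> B2, A1 \<inter> A2) \<in> T"
      if "(B1, A1) \<in> T" "(B2, A2) \<in> T" "f (A1 \<inter> A2) \<le> k" for A1 B1 A2 B2
    proof (rule ccontr)
      have sep: "B1 \<union> A1 = X" "B1 \<inter> A1 = {}" "B2 \<union> A2 = X" "B2 \<inter> A2 = {}"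
        using that(1,2) assms(3) unfolding separations_def by auto
      assume "(B1 \<union> B2, A1 \<inter> A2) \<notin> T"
      moreover have "(A1 \<inter> A2, B1 \<union> B2) \<in> separations X"
        using sep unfolding separations_def by blast
      ultimately have "(A1 \<inter> A2, B1 \<union> B2) \<in> T"
        using T1 that(3) by blast
      moreover have "B1 \<union> B2 \<union> (A1 \<inter> A2) = X"
        using sep by blast
      ultimately show False
        using T3 that(1,2) by blast
    qed
    have F2: "(X, {}) \<notin> T"
      using T3[of X "{}" X "{}" X "{}"] by blast
    have F3: "(X - {e}, {e}) \<notin> T" if "e \<in> X" "f {e} \<le> k" for e
    proof
      assume "(X - {e}, {e}) \<in> T"
      then have "(X - {e}) \<union> {e} \<union> {e} \<noteq> X"
        by (rule T3[OF _ T2[OF that] T2[OF that]])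
      with that(1) show False
        by blast
    qed
    show "ultrafilter_of_separations X f k ?F"
      unfolding ultrafilter_of_separations_def sep_order_def sep_le_def
    proof (intro conjI)
      show "\<forall>S\<in>?F. f (fst S) \<le> k"
        using ord(2) by auto
      show "\<forall>A B. (A, B) \<in> separations X \<and> f (fst (A, B)) \<le> k \<longrightarrow> (A, B) \<in> ?F \<or> (B, A) \<in> ?F"
        using T1 by auto
      show "\<forall>A1 B1 A2 B2. (A1, B1) \<in> ?F \<and> (A2, B2) \<in> separations X \<and>
          (fst (A1, B1) \<subseteq> fst (A2, B2) \<and> snd (A2, B2) \<subseteq> snd (A1, B1)) \<and> f (fst (A2, B2)) \<le> k
          \<longrightarrow> (A2, B2) \<in> ?F"
        using F4 by simp blast
    qed (use F_sep F2 F3 F5 in simp_all)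
  next
    assume uf: "ultrafilter_of_separations X f k ?F"
    note uf_axioms = uf[unfolded ultrafilter_of_separations_def sep_order_def sep_le_def
        mem_Collect_eq case_prod_conv fst_conv snd_conv]
    have ord: "f A \<le> k" if "(A, B) \<in> T" for A B
    proof -
      have "(B, A) \<in> ?F"
        using that by simp
      then have "f (fst (B, A)) \<le> k"
        using uf_axioms by blast
      then show ?thesis
        using order_swap[OF that] by simp
    qed
    have F1: "(B, A) \<in> T \<or> (A, B) \<in> T" if "(A, B) \<in> separations X" "f A \<le> k" for A B
      using uf_axioms that by blast
    have F3: "(X - {e}, {e}) \<notin> T" if "e \<in> X" "f {e} \<le> k" for e
      using uf_axioms that by blast
    have F4: "(B2, A2) \<in> T"
      if "(B1, A1) \<in> T" "(A2, B2) \<in> separations X" "A1 \<subseteq> A2" "B2 \<subseteq> B1" "f A2 \<le> k"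
      for A1 B1 A2 B2
      using uf_axioms that by blast
    have F5: "(B1 \<union> B2, A1 \<inter> A2) \<in> T"
      if "(B1, A1) \<in> T" "(B2, A2) \<in> T" "f (A1 \<inter> A2) \<le> k" for A1 B1 A2 B2
      using uf_axioms that by blast
    have T2: "({e}, X - {e}) \<in> T" if "e \<in> X" "f {e} \<le> k" for e
      \<comment> \<open>(F1) provides one orientation of the singleton separation and (F3) rules out
        the wrong one.\<close>
      using F1[of "{e}" "X - {e}"] F3 that unfolding separations_iff by blast
    \<comment> \<open>Nothing is lost by recording first sides only: \<open>T_sep\<close> shows that
      they determine the second sides.\<close>
    define small where "small A \<longleftrightarrow> (A, X - A) \<in> T" for A
    have small_le: "A \<subseteq> X \<and> f A \<le> k" if "small A" for A
      using that T_sep(1) ord unfolding small_def by blast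
    have small_down: "small B" if "small A" "B \<subseteq> A" "f B \<le> k" for A B
    proof -
      have "B \<subseteq> X"
        using small_le that(1,2) by blast
      \<comment> \<open>Shrinking a small set enlarges its complement, so (F4) is applied to
        \<open>X - A\<close> and \<open>X - B\<close>.\<close>
      then have "(X - B, B) \<in> separations X" "f (X - B) \<le> k"
        using sym that(3) unfolding separations_def by auto
      then show ?thesis
        using F4[of A "X - A" "X - B" B] that unfolding small_def by blast
    qed
    have small_union: "small (A \<union> B)" if "small A" "small B" "f (A \<union> B) \<le> k" for A B
    proof -
      have "(X - A) \<inter> (X - B) = X - (A \<union> B)"
        by blast
      moreover have "f (X - (A \<union> B)) \<le> k"
        using sym[of "A \<union> B"] that small_le by simp
      ultimately show ?thesis
        using F5[of A "X - A" B "X - B"] that(1,2) unfolding small_def by simp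
    qed
    have X_not_small: "\<not> small X"
      \<comment> \<open>Since \<open>X - X\<close> is empty, this is (F2).\<close>
      using uf_axioms unfolding small_def Diff_cancel by blast
    have no_cover: "A \<union> B \<union> C \<noteq> X" if "small A" "small B" "small C" for A B C
      by (rule three_small_sets_no_cover[of X f small k])
        (use assms(2) small_le small_down small_union X_not_small that in blast)+
    have T3: "A1 \<union> A2 \<union> A3 \<noteq> X" if "(A1, B1) \<in> T" "(A2, B2) \<in> T" "(A3, B3) \<in> T"
      for A1 B1 A2 B2 A3 B3
      using no_cover that T_sep(3) unfolding small_def by metis
    show "tangle X f k T"
      unfolding tangle_def sep_order_def
    proof (intro conjI)
      show "\<forall>S\<in>T. f (fst S) \<le> k"
        using ord by auto
      show "\<forall>A B. (A, B) \<in> separations X \<and> f (fst (A, B)) \<le> k \<longrightarrow> (A, B) \<in> T \<or> (B, A) \<in> T"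
        using F1 by auto
      show "\<forall>A1 B1 A2 B2 A3 B3. (A1, B1) \<in> T \<and> (A2, B2) \<in> T \<and> (A3, B3) \<in> T
          \<longrightarrow> A1 \<union> A2 \<union> A3 \<noteq> X"
        using T3 by blast
    qed (use assms(3) T2 in simp_all)
  qed
qed

end
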